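(* For integers $s\ge 3$ and $\ell\ge 2$ let $T_{s,\ell}$ be the subdivided symmetric double star and $\lambda_{s,\ell}:=\lambda_{\max}(R_{T_{s,\ell}})$. (1) If $s=3$, then $\lambda_{\max}(R_{T_{3,\ell}})=0$ for all $\ell\ge 2$. (2) If $s>3$, then $\lambda_{s,\ell+1}<\lambda_{s,\ell}$ for all $\ell\ge 2$, and $\lambda_{s,\ell}\downarrow\lambda_{s,\infty}>0$ as $\ell\to\infty$, where $\lambda_{s,\infty}$ is the unique positive solution of $q(\lambda)=\beta_s(\lambda)$, with $$q(\lambda)=1+\lambda-\sqrt{\lambda(\lambda+2)},\qquad \beta_s(\lambda)=2\lambda+1+\frac{2}{s+1}-\frac{2s}{(s+1)\bigl((s+1)\lambda+3\bigr)}$$ (equivalently, $e^{-t}=\beta_s(\lambda)$ with $t=\operatorname{arcosh}(1+\lambda)$).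
   Context: For a finite tree $T=(V,E)$ let $d_z$ denote the degree of the vertex $z$. The Ricci matrix $R_T\in\mathbb R^{E\times E}$ is the real symmetric matrix indexed by edges with entries $(R_T)_{e,e}=-\left(\frac1{d_x}+\frac1{d_y}\right)$ for $e=\{x,y\}$, $(R_T)_{e,e'}=\frac1{d_z}$ if $e\ne e'$ and $e\cap e'=\{z\}$, and $(R_T)_{e,e'}=0$ if $e\cap e'=\varnothing$. $\lambda_{\max}(M)$ denotes the largest eigenvalue of a real symmetric matrix $M$. The symmetric double star $S_{s,s}$ consists of two adjacent centers, each having $s$ leaf neighbours. $T_{s,\ell}$ is obtained from $S_{s,s}$ by replacing the central edge with a path of length $\ell$ between the two centers; the two centers have degree $s+1$ and the $\ell-1$ interior chain vertices have degree $2$. The notation $\lambda_{s,\ell}\downarrow\lambda_{s,\infty}$ means that the sequence decreases in $\ell$ and converges to $\lambda_{s,\infty}$. *)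

theory Defs
  imports Complex_Main "Jordan_Normal_Form.Char_Poly"
begin

text \<open>A finite simple graph is given by its edge set, a set of two-element sets of vertices.\<close>

definition vertex_degree :: "'v set set \<Rightarrow> 'v \<Rightarrow> nat" where
  "vertex_degree E z = card {e \<in> E. z \<in> e}"

text \<open>Two distinct edges of a simple graph share at most one vertex, so the sum in the
  off-diagonal case has at most one term: it is \<open>1 / d\<^sub>z\<close> if \<open>e \<inter> f = {z}\<close>
  and \<open>0\<close> if \<open>e \<inter> f = {}\<close>.\<close>

definition ricci_entry :: "'v set set \<Rightarrow> 'v set \<Rightarrow> 'v set \<Rightarrow> real" where
  "ricci_entry E e f =
     (if e = f then - (\<Sum>z\<in>e. 1 / real (vertex_degree E z))
      else (\<Sum>z\<in>e \<inter> f. 1 / real (vertex_degree E z)))"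

definition mat_of_enum :: "'i list \<Rightarrow> ('i \<Rightarrow> 'i \<Rightarrow> 'a) \<Rightarrow> 'a mat" where
  "mat_of_enum xs M = mat (length xs) (length xs) (\<lambda>(i, j). M (xs ! i) (xs ! j))"

text \<open>An \<open>E \<times> E\<close> matrix is turned into a library matrix by means of an enumeration of
  the finite set \<open>E\<close>. The choice of the enumeration has no influence on the eigenvalues, see
  \<open>eigenvalue_ricci_matrix\<close> and \<open>eigenvalue_ricci_matrix_enum\<close> below.\<close>

definition ricci_matrix :: "'v set set \<Rightarrow> real mat" where
  "ricci_matrix E = mat_of_enum (SOME es. distinct es \<and> set es = E) (ricci_entry E)"

text \<open>Meant for real symmetric matrices of positive dimension, whose eigenvalues form a finite
  nonempty set of reals.\<close>

definition lambda_max :: "real mat \<Rightarrow> real" where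
  "lambda_max A = Max {k. eigenvalue A k}"

text \<open>The vertices of the subdivided double star: the path between the centers is
  \<open>Chain 0, \<dots>, Chain l\<close> with centers \<open>Chain 0\<close> and \<open>Chain l\<close>, whose leaves are
  \<open>Leaf False i\<close> and \<open>Leaf True i\<close>, respectively, for \<open>i < s\<close>.\<close>

datatype ds_vertex = Chain nat | Leaf bool nat

definition double_star :: "nat \<Rightarrow> nat \<Rightarrow> ds_vertex set set" where
  "double_star s l =
     {{Chain k, Chain (Suc k)} | k. k < l} \<union>
     {{Chain 0, Leaf False i} | i. i < s} \<union>
     {{Chain l, Leaf True i} | i. i < s}"

definition lambda_ds :: "nat \<Rightarrow> nat \<Rightarrow> real" where
  "lambda_ds s l = lambda_max (ricci_matrix (double_star s l))"

definition q_fun :: "real \<Rightarrow> real" where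
  "q_fun x = 1 + x - sqrt (x * (x + 2))"

definition beta_fun :: "nat \<Rightarrow> real \<Rightarrow> real" where
  "beta_fun s x =
     2 * x + 1 + 2 / (real s + 1) - 2 * real s / ((real s + 1) * ((real s + 1) * x + 3))"

lemma eigenvalue_mat_of_enum:
  fixes M :: "'i \<Rightarrow> 'i \<Rightarrow> 'a :: comm_ring_1"
  assumes "distinct xs"
  shows "eigenvalue (mat_of_enum xs M) k \<longleftrightarrow>
    (\<exists>v. (\<exists>x\<in>set xs. v x \<noteq> 0) \<and> (\<forall>x\<in>set xs. (\<Sum>y\<in>set xs. M x y * v y) = k * v x))"
    (is "?L \<longleftrightarrow> ?R")
proof -
  define n where "n = length xs"
  have bij: "bij_betw (\<lambda>i. xs ! i) {0..<n} (set xs)"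
    using assms by (auto simp: bij_betw_def inj_on_def nth_eq_iff_index_eq n_def set_conv_nth)
  have dim: "dim_row (mat_of_enum xs M) = n" "dim_col (mat_of_enum xs M) = n"
    by (auto simp: mat_of_enum_def n_def)
  have mul: "(mat_of_enum xs M *\<^sub>v w) $ i = (\<Sum>j\<in>{0..<n}. M (xs ! i) (xs ! j) * w $ j)"
    if "i < n" "w \<in> carrier_vec n" for i and w :: "'a vec"
    using that by (auto simp: mat_of_enum_def n_def scalar_prod_def)
  have re: "(\<Sum>j\<in>{0..<n}. g (xs ! j)) = (\<Sum>y\<in>set xs. g y)" for g :: "'i \<Rightarrow> 'a"
    by (rule sum.reindex_bij_betw[OF bij])
  show ?thesis
  proof
    assume ?L
    then obtain w where w: "w \<in> carrier_vec n" "w \<noteq> 0\<^sub>v n" "mat_of_enum xs M *\<^sub>v w = k \<cdot>\<^sub>v w"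
      by (auto simp: eigenvalue_def eigenvector_def dim)
    define v where "v x = w $ (the_inv_into {0..<n} (\<lambda>i. xs ! i) x)" for x
    have v: "v (xs ! i) = w $ i" if "i < n" for i
      using that bij by (simp add: v_def bij_betw_def the_inv_into_f_f)
    obtain i where i: "i < n" "w $ i \<noteq> 0"
      using w(1,2) by (metis carrier_vecD eq_vecI index_zero_vec)
    have "(\<Sum>y\<in>set xs. M x y * v y) = k * v x" if x: "x \<in> set xs" for x
    proof -
      obtain j where j: "j < n" "x = xs ! j" using x by (auto simp: in_set_conv_nth n_def)
      have "(\<Sum>y\<in>set xs. M x y * v y) = (\<Sum>i\<in>{0..<n}. M x (xs ! i) * w $ i)"
        by (subst re[symmetric]) (auto intro: sum.cong simp: v)
      also have "\<dots> = (k \<cdot>\<^sub>v w) $ j" using mul[OF j(1) w(1)] w(3) j by simp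
      also have "\<dots> = k * v x" using j w(1) by (simp add: v)
      finally show ?thesis .
    qed
    moreover have "xs ! i \<in> set xs" "v (xs ! i) \<noteq> 0" using i by (auto simp: v n_def)
    ultimately show ?R by blast
  next
    assume ?R
    then obtain v where v: "\<exists>x\<in>set xs. v x \<noteq> 0"
      "\<And>x. x \<in> set xs \<Longrightarrow> (\<Sum>y\<in>set xs. M x y * v y) = k * v x" by blast
    define w where "w = vec n (\<lambda>i. v (xs ! i))"
    have w: "w \<in> carrier_vec n" by (simp add: w_def)
    obtain i where "i < n" "v (xs ! i) \<noteq> 0" using v(1) by (auto simp: in_set_conv_nth n_def)
    hence "w \<noteq> 0\<^sub>v n" by (metis index_vec index_zero_vec(1) w_def)
    moreover have "mat_of_enum xs M *\<^sub>v w = k \<cdot>\<^sub>v w"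
    proof (rule eq_vecI)
      fix i assume "i < dim_vec (k \<cdot>\<^sub>v w)"
      hence i: "i < n" by (simp add: w_def)
      hence "(mat_of_enum xs M *\<^sub>v w) $ i = (\<Sum>j\<in>{0..<n}. M (xs ! i) (xs ! j) * v (xs ! j))"
        by (simp add: mul[OF i w]) (simp add: w_def)
      also have "\<dots> = k * v (xs ! i)"
        using re[of "\<lambda>y. M (xs ! i) y * v y"] v(2)[of "xs ! i"] i by (simp add: n_def)
      finally show "(mat_of_enum xs M *\<^sub>v w) $ i = (k \<cdot>\<^sub>v w) $ i" using i by (simp add: w_def)
    qed (simp add: dim w_def)
    ultimately show ?L using w by (auto simp: eigenvalue_def eigenvector_def dim)
  qed
qed

lemma eigenvalue_ricci_matrix:
  assumes "finite E"
  shows "eigenvalue (ricci_matrix E) k \<longleftrightarrow>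
    (\<exists>v. (\<exists>e\<in>E. v e \<noteq> 0) \<and> (\<forall>e\<in>E. (\<Sum>f\<in>E. ricci_entry E e f * v f) = k * v e))"
proof -
  define es where "es = (SOME es. distinct es \<and> set es = E)"
  have "distinct es \<and> set es = E"
    unfolding es_def by (rule someI_ex) (use finite_distinct_list[OF assms] in blast)
  thus ?thesis
    using eigenvalue_mat_of_enum[of es "ricci_entry E" k]
    by (simp add: ricci_matrix_def es_def)
qed

lemma eigenvalue_ricci_matrix_enum:
  assumes "distinct es" "set es = E"
  shows "eigenvalue (ricci_matrix E) k \<longleftrightarrow> eigenvalue (mat_of_enum es (ricci_entry E)) k"
  using assms by (subst eigenvalue_ricci_matrix) (auto simp: eigenvalue_mat_of_enum)

lemma finite_double_star: "finite (double_star s l)"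
  by (simp add: double_star_def)

lemma degree_double_star_Leaf:
  assumes "i < s"
  shows "vertex_degree (double_star s l) (Leaf b i) = 1"
proof -
  have "{e \<in> double_star s l. Leaf b i \<in> e} = {{Chain (if b then l else 0), Leaf b i}}"
    using assms by (auto simp: double_star_def)
  thus ?thesis by (simp add: vertex_degree_def)
qed

lemma degree_double_star_interior:
  assumes "0 < k" "k < l"
  shows "vertex_degree (double_star s l) (Chain k) = 2"
proof -
  obtain m where m: "k = Suc m" using assms by (cases k) auto
  have "{e \<in> double_star s l. Chain k \<in> e} = {{Chain m, Chain k}, {Chain k, Chain (Suc k)}}"
    using assms by (auto simp: double_star_def m)
  moreover have "{Chain m, Chain k} \<noteq> {Chain k, Chain (Suc k)}"
    by (auto simp: m doubleton_eq_iff)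
  ultimately show ?thesis by (simp add: vertex_degree_def)
qed

lemma degree_double_star_center:
  assumes "0 < l" "k = 0 \<or> k = l"
  shows "vertex_degree (double_star s l) (Chain k) = s + 1"
proof -
  define b where "b = (k = l)"
  define p where "p = (if b then {Chain (l - 1), Chain l} else {Chain 0, Chain 1})"
  have "{e \<in> double_star s l. Chain k \<in> e} = insert p ((\<lambda>i. {Chain k, Leaf b i}) ` {..<s})"
    using assms by (cases l) (auto simp: double_star_def p_def b_def)
  moreover have "p \<notin> (\<lambda>i. {Chain k, Leaf b i}) ` {..<s}"
    by (auto simp: p_def doubleton_eq_iff)
  moreover have "card ((\<lambda>i. {Chain k, Leaf b i}) ` {..<s}) = s"
    by (subst card_image) (auto simp: inj_on_def doubleton_eq_iff)
  ultimately show ?thesis by (simp add: vertex_degree_def)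
qed

end

theory Submission
  imports Defs
begin

text \<open>
  The off-diagonal entries of the Ricci matrix are nonnegative, so the eigenvalue of any positive
  eigenvector is the largest one. Write \<open>\<lambda> = (1 - r)\<^sup>2 / (2 r)\<close>, so that \<open>r\<close> and \<open>1 / r\<close> are the
  roots of the chain recurrence \<open>2 (1 + \<lambda>) c\<^sub>k = c\<^sub>k\<^sub>-\<^sub>1 + c\<^sub>k\<^sub>+\<^sub>1\<close> and \<open>q(\<lambda>) = r\<close>. The symmetric
  solution \<open>c\<^sub>k = r\<^sup>k + r\<^sup>l\<^sup>-\<^sup>1\<^sup>-\<^sup>k\<close>, constant on the leaf edges, is then an eigenvector if and only if
  \<open>c\<^sub>1 / c\<^sub>0 = \<beta>\<^sub>s(\<lambda>)\<close>. The left-hand side is increasing in \<open>r\<close>, decreasing in \<open>l\<close> and tends to \<open>r\<close>,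
  whereas the right-hand side is strictly decreasing in \<open>r\<close>.
\<close>

section \<open>Positive eigenvectors and the largest eigenvalue\<close>

text \<open>Perron-type comparison: take the least multiple \<open>t * v\<close> lying above the
  eigenvector and evaluate the eigenvalue equation at an index where the two touch.\<close>

lemma eigenvalue_le_of_pos_supervector:
  fixes M :: "'i \<Rightarrow> 'i \<Rightarrow> real"
  assumes fin: "finite I"
    and off: "\<And>x y. x \<in> I \<Longrightarrow> y \<in> I \<Longrightarrow> x \<noteq> y \<Longrightarrow> M x y \<ge> 0"
    and pos: "\<And>x. x \<in> I \<Longrightarrow> v x > 0"
    and super: "\<And>x. x \<in> I \<Longrightarrow> (\<Sum>y\<in>I. M x y * v y) \<le> k * v x"
    and nz: "\<exists>x\<in>I. u x \<noteq> 0"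
    and eig: "\<And>x. x \<in> I \<Longrightarrow> (\<Sum>y\<in>I. M x y * u y) = m * u x"
  shows "m \<le> k"
proof -
  have main: "m \<le> k" if w: "\<And>x. x \<in> I \<Longrightarrow> (\<Sum>y\<in>I. M x y * w y) = m * w x"
    and wp: "x0 \<in> I" "w x0 > 0" for w x0
  proof -
    \<comment> \<open>The touching index: minimising the negated ratio maximises
      \<open>w / v\<close>.\<close>
    define x where "x = arg_min_on (\<lambda>x. - (w x / v x)) I"
    have ne: "I \<noteq> {}" using wp by auto
    have x: "x \<in> I" unfolding x_def by (rule arg_min_if_finite(1)[OF fin ne])
    have max: "w y / v y \<le> w x / v x" if "y \<in> I" for y
      using arg_min_least[OF fin ne that, of "\<lambda>x. - (w x / v x)"] by (simp add: x_def)
    define t where "t = w x / v x"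
    have wy: "w y \<le> t * v y" if "y \<in> I" for y
      using max[OF that] pos[OF that] by (simp add: t_def pos_divide_le_eq)
    have wx: "w x = t * v x" using pos[OF x] by (simp add: t_def)
    have "0 < w x0 / v x0" using wp pos by simp
    hence t: "t > 0" using max[OF wp(1)] by (simp add: t_def)
    have "m * w x = (\<Sum>y\<in>I. M x y * w y)" using w[OF x] by simp
    also have "\<dots> \<le> (\<Sum>y\<in>I. M x y * (t * v y))"
    \<comment> \<open>The diagonal entry may be negative, but its two terms agree because
      \<open>w x = t * v x\<close>; all other entries are nonnegative.\<close>
    proof (rule sum_mono)
      fix y assume "y \<in> I"
      thus "M x y * w y \<le> M x y * (t * v y)"
        using wx wy off[OF x] by (cases "x = y") (auto intro: mult_left_mono)
    qed
    also have "\<dots> = t * (\<Sum>y\<in>I. M x y * v y)" by (simp add: sum_distrib_left algebra_simps)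
    also have "\<dots> \<le> t * (k * v x)" using super[OF x] t by simp
    also have "\<dots> = k * w x" by (simp add: wx)
    finally show ?thesis using t pos[OF x] wx by simp
  qed
  \<comment> \<open>Either \<open>u\<close> or \<open>- u\<close> has a positive entry, and both are
    eigenvectors for \<open>m\<close>.\<close>
  obtain x0 where x0: "x0 \<in> I" "u x0 \<noteq> 0" using nz by auto
  show ?thesis
  proof (cases "u x0 > 0")
    case True
    thus ?thesis using main[of u x0] eig x0 by auto
  next
    case False
    have "(\<Sum>y\<in>I. M x y * - u y) = m * - u x" if "x \<in> I" for x
      using eig[OF that] by (simp add: sum_negf)
    thus ?thesis using main[of "\<lambda>x. - u x" x0] x0 False by auto
  qed
qed

lemma finite_eigenvalues:
  fixes A :: "'a :: field mat"
  assumes A: "A \<in> carrier_mat n n"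
  shows "finite {k. eigenvalue A k}"
proof -
  have "char_poly A \<noteq> 0" using degree_monic_char_poly[OF A] by auto
  thus ?thesis using poly_roots_finite[of "char_poly A"] eigenvalue_root_char_poly[OF A] by simp
qed

lemma lambda_max_ricci_eqI:
  assumes "finite E" "E \<noteq> {}"
    and "\<And>e. e \<in> E \<Longrightarrow> v e > 0"
    and "\<And>e. e \<in> E \<Longrightarrow> (\<Sum>f\<in>E. ricci_entry E e f * v f) = k * v e"
  shows "lambda_max (ricci_matrix E) = k"
  unfolding lambda_max_def
proof (rule Max_eqI)
  show "finite {k. eigenvalue (ricci_matrix E) k}"
    by (rule finite_eigenvalues) (auto simp: ricci_matrix_def mat_of_enum_def)
  have "\<exists>e\<in>E. v e \<noteq> 0" using assms(2,3) by force
  thus "k \<in> {k. eigenvalue (ricci_matrix E) k}"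
    using assms(4) by (auto simp: eigenvalue_ricci_matrix[OF assms(1)])
  fix m assume "m \<in> {k. eigenvalue (ricci_matrix E) k}"
  then obtain u where "\<exists>e\<in>E. u e \<noteq> 0" "\<And>e. e \<in> E \<Longrightarrow> (\<Sum>f\<in>E. ricci_entry E e f * u f) = m * u e"
    by (auto simp: eigenvalue_ricci_matrix[OF assms(1)])
  moreover have "ricci_entry E e f \<ge> 0" if "e \<noteq> f" for e f
    using that by (auto simp: ricci_entry_def intro: sum_nonneg)
  ultimately show "m \<le> k"
    using eigenvalue_le_of_pos_supervector[of E "ricci_entry E" v k u m] assms by auto
qed

section \<open>Action of the Ricci matrix on edge weights of the double star\<close>

text \<open>Writing the diagonal contribution \<open>-1/d\<close> of each endpoint as
  \<open>1/d - 2/d\<close> lets \<open>e\<close> join the other edges at \<open>z\<close>, so a row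
  is determined by vertex degrees and sums over vertex stars.\<close>

lemma ricci_row_sum:
  assumes "finite E" "e \<in> E" "finite e"
  shows "(\<Sum>f\<in>E. ricci_entry E e f * v f) =
    (\<Sum>z\<in>e. (sum v {f \<in> E. z \<in> f} - 2 * v e) / real (vertex_degree E z))"
proof -
  define d where "d z = 1 / real (vertex_degree E z)" for z
  have entry: "ricci_entry E e f * v f =
      (\<Sum>z\<in>e. if z \<in> f then d z * v f else 0) - (if e = f then 2 * v e * sum d e else 0)" for f
  proof -
    have "(\<Sum>z\<in>e. if z \<in> f then d z * v f else 0) = sum d (e \<inter> f) * v f"
      by (simp add: sum.inter_restrict[OF assms(3)] sum_distrib_right if_distrib[of "\<lambda>x. x * v f"]
          cong: if_cong)
    thus ?thesis by (auto simp: ricci_entry_def d_def[symmetric] algebra_simps)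
  qed
  have "(\<Sum>f\<in>E. ricci_entry E e f * v f) =
      (\<Sum>z\<in>e. \<Sum>f\<in>E. if z \<in> f then d z * v f else 0) - 2 * v e * sum d e"
    using assms by (simp add: entry sum_subtractf sum.swap[of _ e])
  also have "(\<Sum>z\<in>e. \<Sum>f\<in>E. if z \<in> f then d z * v f else 0) =
      (\<Sum>z\<in>e. d z * sum v {f \<in> E. z \<in> f})"
    using assms(1) by (simp add: sum.inter_filter[symmetric] sum_distrib_left)
  also have "\<dots> - 2 * v e * sum d e = (\<Sum>z\<in>e. d z * sum v {f \<in> E. z \<in> f} - d z * (2 * v e))"
    by (simp add: sum_subtractf sum_distrib_left sum_distrib_right mult_ac)
  finally show ?thesis by (simp add: d_def diff_divide_distrib)
qed

text \<open>Shape of the trial eigenvector. Edges are unordered, so \<open>LEAST\<close> recovers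
  the position of a chain edge from its smaller index.\<close>

definition ds_weight :: "real \<Rightarrow> (nat \<Rightarrow> real) \<Rightarrow> ds_vertex set \<Rightarrow> real" where
  "ds_weight a c e = (if \<exists>b i. Leaf b i \<in> e then a else c (LEAST k. Chain k \<in> e))"

lemma ds_weight_leaf [simp]: "ds_weight a c {Chain k, Leaf b i} = a"
  by (auto simp: ds_weight_def)

lemma ds_weight_chain [simp]: "ds_weight a c {Chain k, Chain (Suc k)} = c k"
proof -
  have "(LEAST j. Chain j \<in> {Chain k, Chain (Suc k)}) = k"
    by (rule Least_equality) auto
  thus ?thesis by (simp add: ds_weight_def)
qed

lemma sum_ds_weight_leaf:
  assumes "i < s"
  shows "sum (ds_weight a c) {e \<in> double_star s l. Leaf b i \<in> e} = a"
proof -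
  have "{e \<in> double_star s l. Leaf b i \<in> e} = {{Chain (if b then l else 0), Leaf b i}}"
    using assms by (auto simp: double_star_def)
  thus ?thesis by simp
qed

lemma sum_ds_weight_interior:
  assumes "Suc k < l"
  shows "sum (ds_weight a c) {e \<in> double_star s l. Chain (Suc k) \<in> e} = c k + c (Suc k)"
proof -
  have "{e \<in> double_star s l. Chain (Suc k) \<in> e} =
      {{Chain k, Chain (Suc k)}, {Chain (Suc k), Chain (Suc (Suc k))}}"
    using assms by (auto simp: double_star_def)
  moreover have "{Chain k, Chain (Suc k)} \<noteq> {Chain (Suc k), Chain (Suc (Suc k))}"
    by (auto simp: doubleton_eq_iff)
  ultimately show ?thesis by simp
qed

lemma sum_ds_weight_leaves:
  "sum (ds_weight a c) ((\<lambda>i. {Chain k, Leaf b i}) ` {..<s}) = real s * a"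
  by (subst sum.reindex) (auto simp: inj_on_def doubleton_eq_iff)

lemma sum_ds_weight_center_left:
  assumes "0 < l"
  shows "sum (ds_weight a c) {e \<in> double_star s l. Chain 0 \<in> e} = c 0 + real s * a"
proof -
  have "{e \<in> double_star s l. Chain 0 \<in> e} =
      insert {Chain 0, Chain (Suc 0)} ((\<lambda>i. {Chain 0, Leaf False i}) ` {..<s})"
    using assms by (auto simp: double_star_def)
  moreover have "{Chain 0, Chain (Suc 0)} \<notin> (\<lambda>i. {Chain 0, Leaf False i}) ` {..<s}"
    by (auto simp: doubleton_eq_iff)
  ultimately show ?thesis by (simp add: sum_ds_weight_leaves)
qed

lemma sum_ds_weight_center_right:
  "sum (ds_weight a c) {e \<in> double_star s (Suc m). Chain (Suc m) \<in> e} = c m + real s * a"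
proof -
  have "{e \<in> double_star s (Suc m). Chain (Suc m) \<in> e} =
      insert {Chain m, Chain (Suc m)} ((\<lambda>i. {Chain (Suc m), Leaf True i}) ` {..<s})"
    by (auto simp: double_star_def)
  moreover have "{Chain m, Chain (Suc m)} \<notin> (\<lambda>i. {Chain (Suc m), Leaf True i}) ` {..<s}"
    by (auto simp: doubleton_eq_iff)
  ultimately show ?thesis by (simp add: sum_ds_weight_leaves)
qed

section \<open>Reduction of the eigenvalue equation to the chain recurrence\<close>

text \<open>The hypotheses \<open>leaf\<close>, \<open>center\<close> and \<open>interior\<close>
  are the eigenvalue equations for the three types of edges; \<open>symm\<close> carries the first
  two over to the other end of the chain, whose last edge has index \<open>Suc n\<close>.\<close>

lemma lambda_ds_eqI:
  assumes a: "a > 0" and c: "\<And>k. k \<le> Suc n \<Longrightarrow> c k > 0"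
    and leaf: "((real s + 1) * x + 3) * a = c 0"
    and center: "x * c 0 = (real s * a - c 0) / (real s + 1) + (c 1 - c 0) / 2"
    and interior: "\<And>k. k < n \<Longrightarrow> 2 * (1 + x) * c (Suc k) = c k + c (Suc (Suc k))"
    and symm: "c (Suc n) = c 0" "c n = c 1"
  shows "lambda_ds s (n + 2) = x"
  unfolding lambda_ds_def
proof (rule lambda_max_ricci_eqI[where v = "ds_weight a c"])
  let ?l = "n + 2" and ?E = "double_star s (n + 2)"
  have cases: "P e" if "e \<in> ?E"
    "\<And>k. k \<le> Suc n \<Longrightarrow> P {Chain k, Chain (Suc k)}"
    "\<And>b i. i < s \<Longrightarrow> P {Chain (if b then ?l else 0), Leaf b i}" for P e
    using that(1) that(2) that(3)[of _ True] that(3)[of _ False]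
    by (auto simp: double_star_def less_Suc_eq_le)
  show fin: "finite ?E" by (rule finite_double_star)
  have "{Chain 0, Chain (Suc 0)} \<in> ?E" by (auto simp: double_star_def)
  thus "?E \<noteq> {}" by blast
  fix e assume e: "e \<in> ?E"
  show "ds_weight a c e > 0" by (rule cases[OF e]) (auto simp: a c)
  have "finite e" by (rule cases[OF e]) auto
  note row = ricci_row_sum[OF fin e this]
  have deg: "vertex_degree ?E (Chain 0) = s + 1" "vertex_degree ?E (Chain ?l) = s + 1"
    using degree_double_star_center[of ?l] by auto
  have degi: "vertex_degree ?E (Chain (Suc k)) = 2" if "k \<le> n" for k
    using degree_double_star_interior[of "Suc k" ?l s] that by simp
  have S0: "sum (ds_weight a c) {e \<in> ?E. Chain 0 \<in> e} = c 0 + real s * a"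
    by (rule sum_ds_weight_center_left) simp
  have Sl: "sum (ds_weight a c) {e \<in> ?E. Chain ?l \<in> e} = c 0 + real s * a"
    using sum_ds_weight_center_right[of a c s "Suc n"] by (simp add: symm)
  have Si: "sum (ds_weight a c) {e \<in> ?E. Chain (Suc k) \<in> e} = c k + c (Suc k)" if "k \<le> n" for k
    by (rule sum_ds_weight_interior) (use that in simp)
  have chain: "(\<Sum>z\<in>{Chain k, Chain (Suc k)}. (sum (ds_weight a c) {f \<in> ?E. z \<in> f} - 2 * c k) /
      real (vertex_degree ?E z)) = x * c k" if k: "k \<le> Suc n" for k
  proof -
    \<comment> \<open>The two extreme chain edges join a center to a vertex of degree 2; every other
      chain edge joins two vertices of degree 2.\<close>
    consider "k = 0" | "k = Suc n" | j where "k = Suc j" "j < n"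
      using k by (cases k) force+
    thus ?thesis
    proof cases
      case 1
      thus ?thesis using center S0 deg Si[of 0] degi[of 0] by (simp add: add_ac)
    next
      case 2
      thus ?thesis using center Sl deg Si[of n] degi[of n] symm by (simp add: add_ac)
    next
      case 3
      thus ?thesis using interior[of j] Si[of j] Si[of "Suc j"] degi[of j] degi[of "Suc j"]
        by (simp add: field_simps)
    qed
  qed
  \<comment> \<open>The leaf vertex has degree 1 and star sum \<open>a\<close>, hence contributes
    \<open>a - 2 * a = - a\<close>.\<close>
  have leaf': "(c 0 + real s * a - 2 * a) / (real s + 1) - a = x * a"
    using leaf[symmetric] by (simp add: field_simps)
  have leafedge: "(\<Sum>z\<in>{Chain (if b then ?l else 0), Leaf b i}.
      (sum (ds_weight a c) {f \<in> ?E. z \<in> f} - 2 * a) / real (vertex_degree ?E z)) = x * a"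
    if i: "i < s" for b i
    using leaf' S0 Sl deg sum_ds_weight_leaf[OF i, of a c ?l b] degree_double_star_Leaf[OF i, of ?l b]
    by (auto simp: add_ac)
  have "(\<Sum>z\<in>e. (sum (ds_weight a c) {f \<in> ?E. z \<in> f} - 2 * ds_weight a c e) /
      real (vertex_degree ?E z)) = x * ds_weight a c e"
    by (rule cases[OF e]) (use chain leafedge in \<open>simp_all only: ds_weight_leaf ds_weight_chain\<close>)
  with row show "(\<Sum>f\<in>?E. ricci_entry ?E e f * ds_weight a c f) = x * ds_weight a c e" by simp
qed

text \<open>For \<open>r = exp (- t)\<close> this is \<open>cosh t - 1\<close>. On (0, 1] it inverts
  \<open>q_fun\<close> and avoids the square root.\<close>

definition lam_of :: "real \<Rightarrow> real" where
  "lam_of r = (1 - r)\<^sup>2 / (2 * r)"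

text \<open>The ratio \<open>c\<^sub>1 / c\<^sub>0\<close> for chain length \<open>n + 2\<close>.\<close>

definition chain_ratio :: "nat \<Rightarrow> real \<Rightarrow> real" where
  "chain_ratio n r = (r + r ^ n) / (1 + r ^ Suc n)"

text \<open>Eliminating the leaf weight \<open>a\<close> through the leaf equation turns the center
  equation into \<open>c 1 = beta_fun s x * c 0\<close>, which is the hypothesis
  \<open>eq\<close>.\<close>

lemma lambda_ds_eq_lam_of:
  assumes r: "r > 0" and eq: "beta_fun s (lam_of r) = chain_ratio n r"
  shows "lambda_ds s (n + 2) = lam_of r"
proof -
  define c where "c k = r ^ k + r ^ (Suc n - k)" for k
  define x where "x = lam_of r"
  define a where "a = c 0 / ((real s + 1) * x + 3)"
  have x: "x \<ge> 0" using r by (simp add: x_def lam_of_def)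
  have cpos: "c k > 0" for k using r by (simp add: c_def add_pos_pos)
  have den: "(real s + 1) * x + 3 > 0" using x by (simp add: add_nonneg_pos)
  have "c 1 = beta_fun s x * c 0"
    using eq cpos[of 0] by (simp add: x_def chain_ratio_def c_def)
  also have "\<dots> = (2 * x + 1 + 2 / (real s + 1)) * c 0 - 2 * real s * a / (real s + 1)"
    by (simp add: beta_fun_def a_def left_diff_distrib)
  finally have c1: "c 1 = (2 * x + 1 + 2 / (real s + 1)) * c 0 - 2 * real s * a / (real s + 1)" .
  have x1: "2 * (1 + x) * r = 1 + r\<^sup>2"
    using r by (simp add: x_def lam_of_def field_simps power2_eq_square)
  have "lambda_ds s (n + 2) = x"
  proof (rule lambda_ds_eqI[where a = a and c = c])
    show "a > 0" using cpos den by (simp add: a_def)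
    show "((real s + 1) * x + 3) * a = c 0" using den by (simp add: a_def)
    show "x * c 0 = (real s * a - c 0) / (real s + 1) + (c 1 - c 0) / 2"
    proof -
      \<comment> \<open>With \<open>y\<close> for \<open>real s * a\<close> and \<open>D\<close> for
        \<open>real s + 1\<close>, all terms other than \<open>x * c 0\<close> cancel once the
        fractions are split.\<close>
      have "(y - c 0) / D + ((2 * x + 1 + 2 / D) * c 0 - 2 * y / D - c 0) / 2 = x * c 0" for y D
        by (simp add: algebra_simps add_divide_distrib diff_divide_distrib)
      from this[of "real s * a" "real s + 1"] show ?thesis unfolding c1 by (simp only: mult.assoc)
    qed
    fix k assume "k < n"
    \<comment> \<open>This resolves the truncated subtraction: the mirrored exponents become
      \<open>j + 2\<close>, \<open>j + 1\<close> and \<open>j\<close>.\<close>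
    then obtain j where n: "n = Suc (k + j)" by (metis less_iff_Suc_add)
    have "2 * (1 + x) * c (Suc k) = 2 * (1 + x) * r * (r ^ k + r ^ j)"
      by (simp add: c_def n algebra_simps)
    also have "\<dots> = c k + c (Suc (Suc k))"
      unfolding x1 by (simp add: c_def n algebra_simps power2_eq_square)
    finally show "2 * (1 + x) * c (Suc k) = c k + c (Suc (Suc k))" .
  qed (use cpos in \<open>simp_all add: c_def\<close>)
  thus ?thesis by (simp add: x_def)
qed

section \<open>Monotonicity of beta and existence of crossings\<close>

lemma lam_of_strict_antimono:
  assumes "0 < r" "r < r'" "r' \<le> 1"
  shows "lam_of r' < lam_of r"
proof -
  have "(1 - r')\<^sup>2 < (1 - r)\<^sup>2" using assms by (intro power_strict_mono) auto
  thus ?thesis unfolding lam_of_def using assms by (intro frac_less) auto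
qed

lemma beta_fun_strict_mono:
  assumes "0 \<le> x" "x < y"
  shows "beta_fun s x < beta_fun s y"
proof -
  have "(real s + 1) * x + 3 > 0" using assms by (simp add: add_nonneg_pos)
  moreover have "(real s + 1) * x \<le> (real s + 1) * y" using assms by (intro mult_left_mono) auto
  moreover from calculation have "(real s + 1) * y + 3 > 0" by linarith
  ultimately have "2 * real s / ((real s + 1) * ((real s + 1) * y + 3))
      \<le> 2 * real s / ((real s + 1) * ((real s + 1) * x + 3))"
    by (intro divide_left_mono mult_left_mono mult_pos_pos) auto
  thus ?thesis using assms by (simp add: beta_fun_def)
qed

lemma beta_lam_of_strict_antimono:
  assumes "0 < r" "r < r'" "r' \<le> 1"
  shows "beta_fun s (lam_of r') < beta_fun s (lam_of r)"
  using lam_of_strict_antimono[OF assms] assms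
  by (intro beta_fun_strict_mono) (auto simp: lam_of_def)

lemma beta_lam_of_antimono:
  assumes "0 < r" "r \<le> r'" "r' \<le> 1"
  shows "beta_fun s (lam_of r') \<le> beta_fun s (lam_of r)"
  using beta_lam_of_strict_antimono[of r r' s] assms by (cases "r = r'") auto

lemma continuous_on_beta_lam_of:
  "continuous_on {1/3..1} (\<lambda>r. beta_fun s (lam_of r))"
proof -
  have "(real s + 1) * lam_of r + 3 \<noteq> 0" if "r \<in> {1/3..1}" for r
  proof -
    have "lam_of r \<ge> 0" using that by (simp add: lam_of_def)
    hence "(real s + 1) * lam_of r + 3 > 0" by (simp add: add_nonneg_pos)
    thus ?thesis by simp
  qed
  thus ?thesis unfolding beta_fun_def lam_of_def by (intro continuous_intros) auto
qed

text \<open>\<open>beta_fun s 0 - 1\<close> equals \<open>2 * (3 - s) / (3 * (s + 1))\<close>, which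
  is why \<open>s = 3\<close> is the threshold.\<close>

lemma beta_fun_0_less_1:
  assumes "s > 3"
  shows "beta_fun s 0 < 1"
proof -
  have "2 / (real s + 1) = 6 / ((real s + 1) * 3)" by (simp add: field_simps)
  also have "\<dots> < 2 * real s / ((real s + 1) * 3)"
    using assms by (intro divide_strict_right_mono) auto
  finally have "2 / (real s + 1) < 2 * real s / ((real s + 1) * 3)" .
  thus ?thesis by (simp add: beta_fun_def)
qed

text \<open>The point 2/3 is \<open>lam_of (1/3)\<close>, the value at the left end of the interval
  for the intermediate value theorem. There the linear part is 7/3 and the subtracted fraction is at
  most 2/3.\<close>

lemma beta_fun_two_thirds_gt_1: "beta_fun s (2/3) > 1"
proof -
  have "2 * real s / ((real s + 1) * ((real s + 1) * (2/3) + 3)) \<le> 2 * (real s + 1) / ((real s + 1) * 3)"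
    by (intro frac_le mult_left_mono) auto
  also have "\<dots> = 2/3" by (simp add: field_simps)
  finally have "2 * real s / ((real s + 1) * ((real s + 1) * (2/3) + 3)) \<le> 2/3" .
  moreover have "2 / (real s + 1) > 0" by simp
  ultimately show ?thesis unfolding beta_fun_def by linarith
qed

text \<open>Intermediate value theorem on [1/3, 1]; strictness at 1 keeps the crossing below 1.
  Taking \<open>g\<close> as a chain ratio yields the finite eigenvalues, and taking
  \<open>g\<close> as the identity yields the limit.\<close>

lemma beta_lam_of_crossing:
  assumes s: "s > 3" and g: "continuous_on {1/3..1} g" "g (1/3) \<le> 1" "g 1 = 1"
  obtains r where "0 < r" "r < 1" "beta_fun s (lam_of r) = g r"
proof -
  have l: "lam_of (1/3) = 2/3" "lam_of 1 = 0" by (simp_all add: lam_of_def power2_eq_square)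
  have "g (1/3) - beta_fun s (lam_of (1/3)) \<le> 0" "g 1 - beta_fun s (lam_of 1) \<ge> 0"
    unfolding l using g(2,3) beta_fun_0_less_1[OF s] beta_fun_two_thirds_gt_1[of s] by simp_all
  hence "\<exists>r\<ge>1/3. r \<le> 1 \<and> g r - beta_fun s (lam_of r) = 0"
    by (intro IVT') (auto intro!: continuous_intros continuous_on_beta_lam_of g(1))
  then obtain r where r: "1/3 \<le> r" "r \<le> 1" "g r = beta_fun s (lam_of r)" by auto
  moreover have "r \<noteq> 1" using r g l beta_fun_0_less_1[OF s] by auto
  ultimately show thesis using that[of r] by simp
qed

section \<open>Monotonicity and bounds of the chain ratio\<close>

text \<open>On (0, 1] both factors of the numerator are nonnegative and decrease in \<open>r\<close>
  while the denominator grows; this gives the bound by 1 and the monotonicity.\<close>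

lemma one_minus_chain_ratio:
  assumes "r > 0"
  shows "1 - chain_ratio n r = (1 - r) * (1 - r ^ n) / (1 + r ^ Suc n)"
proof -
  have "1 + r ^ Suc n > 0" using assms by (simp add: add_pos_pos)
  thus ?thesis by (simp add: chain_ratio_def field_simps)
qed

lemma chain_ratio_minus_id:
  assumes "r > 0"
  shows "chain_ratio n r - r = r ^ n * (1 - r\<^sup>2) / (1 + r ^ Suc n)"
proof -
  have "1 + r ^ Suc n > 0" using assms by (simp add: add_pos_pos)
  thus ?thesis by (simp add: chain_ratio_def field_simps power2_eq_square)
qed

lemma chain_ratio_le_1:
  assumes "0 < r" "r \<le> 1"
  shows "chain_ratio n r \<le> 1"
proof -
  have "(1 - r) * (1 - r ^ n) / (1 + r ^ Suc n) \<ge> 0"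
    using assms by (auto intro!: divide_nonneg_nonneg mult_nonneg_nonneg power_le_one add_nonneg_nonneg)
  thus ?thesis using one_minus_chain_ratio[of r n] assms by simp
qed

lemma chain_ratio_mono:
  assumes "0 < r" "r \<le> r'" "r' \<le> 1"
  shows "chain_ratio n r \<le> chain_ratio n r'"
proof -
  have "(1 - r') * (1 - r' ^ n) / (1 + r' ^ Suc n) \<le> (1 - r) * (1 - r ^ n) / (1 + r ^ Suc n)"
    using assms power_mono[of r r' n] power_mono[of r r' "Suc n"]
    by (intro frac_le mult_mono mult_nonneg_nonneg)
       (auto simp: power_le_one add_pos_pos simp del: power_Suc)
  thus ?thesis using one_minus_chain_ratio[of r n] one_minus_chain_ratio[of r' n] assms by simp
qed

lemma chain_ratio_Suc_less:
  assumes "0 < r" "r < 1"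
  shows "chain_ratio (Suc n) r < chain_ratio n r"
proof -
  have p: "r ^ n > 0" using assms by simp
  have "(1 + r ^ Suc (Suc n)) > 0" "(1 + r ^ Suc n) > 0" using assms by (simp_all add: add_pos_pos)
  \<comment> \<open>The difference of the cross products; the terms \<open>r\<close> and
    \<open>r ^ (2 * n + 2)\<close> cancel.\<close>
  moreover have "(r + r ^ n) * (1 + r ^ Suc (Suc n)) - (r + r ^ Suc n) * (1 + r ^ Suc n) =
      r ^ n * (1 - r) * (1 - r\<^sup>2)"
    by (simp add: algebra_simps power2_eq_square)
  moreover have "r ^ n * (1 - r) * (1 - r\<^sup>2) > 0"
    using assms by (simp add: power_less_one_iff)
  ultimately show ?thesis unfolding chain_ratio_def by (simp add: divide_less_eq less_divide_eq)
qed

lemma chain_ratio_minus_id_bounds: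
  assumes "0 < r" "r < 1"
  shows "r < chain_ratio n r" "chain_ratio n r - r \<le> r ^ n"
proof -
  have d: "1 + r ^ Suc n > 1" using assms by simp
  have "r ^ n * (1 - r\<^sup>2) > 0" using assms by (simp add: power_less_one_iff)
  hence "r ^ n * (1 - r\<^sup>2) / (1 + r ^ Suc n) > 0" using d by (intro divide_pos_pos) auto
  thus "r < chain_ratio n r" using chain_ratio_minus_id[of r n] assms by simp
  have "r ^ n * (1 - r\<^sup>2) / (1 + r ^ Suc n) \<le> r ^ n * 1 / 1"
    using assms d by (intro frac_le mult_left_mono) (auto simp del: power_Suc)
  thus "chain_ratio n r - r \<le> r ^ n" using chain_ratio_minus_id[of r n] assms by simp
qed

lemma continuous_on_chain_ratio: "continuous_on {1/3..1} (chain_ratio n)"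
proof -
  have "1 + r ^ Suc n \<noteq> 0" if "r \<in> {1/3..1}" for r :: real
  proof -
    have "r ^ Suc n \<ge> 0" using that by (intro zero_le_power) auto
    thus ?thesis by linarith
  qed
  thus ?thesis unfolding chain_ratio_def by (intro continuous_intros) auto
qed

section \<open>The function q as the inverse of the parametrization\<close>

lemma q_fun_lam_of:
  assumes "0 < r" "r \<le> 1"
  shows "q_fun (lam_of r) = r"
proof -
  \<comment> \<open>In terms of \<open>r = exp (- t)\<close> this is
    \<open>(cosh t)^2 - 1 = (sinh t)^2\<close>; \<open>r \<le> 1\<close> makes \<open>sinh t\<close>
    the nonnegative root.\<close>
  have "lam_of r * (lam_of r + 2) = ((1 - r\<^sup>2) / (2 * r))\<^sup>2"
    using assms by (simp add: lam_of_def field_simps power2_eq_square)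
  moreover have "(1 - r\<^sup>2) / (2 * r) \<ge> 0" using assms by (simp add: power_le_one)
  ultimately have "sqrt (lam_of r * (lam_of r + 2)) = (1 - r\<^sup>2) / (2 * r)"
    by (simp only: real_sqrt_unique)
  thus ?thesis using assms by (simp add: q_fun_def lam_of_def field_simps power2_eq_square)
qed

lemma lam_of_q_fun:
  assumes "x > 0"
  shows "0 < q_fun x" "q_fun x < 1" "lam_of (q_fun x) = x"
proof -
  define w where "w = sqrt (x * (x + 2))"
  have w2: "w\<^sup>2 = x * (x + 2)" using assms by (simp add: w_def)
  have "w < sqrt ((1 + x)\<^sup>2)"
    unfolding w_def by (rule real_sqrt_less_mono) (simp add: power2_eq_square algebra_simps)
  thus q: "0 < q_fun x" using assms by (simp add: q_fun_def w_def)
  have "sqrt (x\<^sup>2) < w"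
    unfolding w_def using assms by (intro real_sqrt_less_mono) (simp add: power2_eq_square)
  thus "q_fun x < 1" using assms by (simp add: q_fun_def w_def)
  \<comment> \<open>Equivalently, \<open>q_fun x\<close> is a root of the characteristic polynomial
    \<open>r^2 - 2 * (1 + x) * r + 1\<close> of the chain recurrence.\<close>
  have "(1 - q_fun x)\<^sup>2 = 2 * q_fun x * x"
    using w2 unfolding q_fun_def w_def[symmetric] by (simp add: power2_eq_square algebra_simps)
  thus "lam_of (q_fun x) = x" using q by (simp add: lam_of_def)
qed

text \<open>The numbers \<open>1 + x + w\<close> and \<open>1 + x - w\<close> with
  \<open>w = sqrt (x * (x + 2))\<close> are reciprocal, since
  \<open>(1 + x)^2 - w^2 = 1\<close>.\<close>

lemma exp_minus_arcosh:
  assumes "x > 0"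
  shows "exp (- arcosh (1 + x)) = q_fun x"
proof -
  have e: "(1 + x)\<^sup>2 - 1 = x * (x + 2)" by (simp add: power2_eq_square algebra_simps)
  have w: "sqrt (x * (x + 2)) ^ 2 = x * (x + 2)" "sqrt (x * (x + 2)) \<ge> 0" using assms by simp_all
  hence p: "1 + x + sqrt (x * (x + 2)) > 0" using assms by linarith
  have "arcosh (1 + x) = ln (1 + x + sqrt (x * (x + 2)))"
    using assms by (simp add: arcosh_real_def e)
  hence "exp (- arcosh (1 + x)) = inverse (1 + x + sqrt (x * (x + 2)))"
    using p by (simp add: exp_minus)
  also have "(1 + x + sqrt (x * (x + 2))) * q_fun x = 1"
    using w by (simp add: q_fun_def power2_eq_square algebra_simps)
  hence "inverse (1 + x + sqrt (x * (x + 2))) = q_fun x" by (rule inverse_unique)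
  finally show ?thesis .
qed

section \<open>Dependence of the largest eigenvalue on the chain length\<close>

text \<open>The parameter is \<open>r = 1\<close>, with constant chain weights:
  \<open>lam_of 1 = 0\<close>, and both the chain ratio at 1 and \<open>beta_fun 3 0\<close> equal
  1.\<close>

lemma lambda_ds_3: "lambda_ds 3 (n + 2) = 0"
  using lambda_ds_eq_lam_of[of 1 3 n] by (simp add: lam_of_def chain_ratio_def beta_fun_def)

theorem corollary3:
  fixes s :: nat
  assumes "s \<ge> 3"
  shows "(s = 3 \<longrightarrow> (\<forall>l\<ge>2. lambda_ds s l = 0)) \<and>
    (s > 3 \<longrightarrow>
      (\<forall>l\<ge>2. lambda_ds s (l + 1) < lambda_ds s l) \<and>
      (\<forall>x>0. q_fun x = beta_fun s x \<longleftrightarrow> exp (- arcosh (1 + x)) = beta_fun s x) \<and>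
      (\<exists>lam_inf>0.
        (\<forall>x>0. q_fun x = beta_fun s x \<longleftrightarrow> x = lam_inf) \<and>
        (\<lambda>l. lambda_ds s l) \<longlonglongrightarrow> lam_inf))"
proof (intro conjI impI)
  assume "s = 3"
  show "\<forall>l\<ge>2. lambda_ds s l = 0"
  proof (intro allI impI)
    fix l :: nat assume "l \<ge> 2"
    then obtain n where "l = n + 2" by (metis le_add_diff_inverse2)
    thus "lambda_ds s l = 0" using lambda_ds_3[of n] \<open>s = 3\<close> by simp
  qed
next
  show "\<forall>x>0. q_fun x = beta_fun s x \<longleftrightarrow> exp (- arcosh (1 + x)) = beta_fun s x"
    by (simp add: exp_minus_arcosh)
next
  assume s: "s > 3"
  define B where "B r = beta_fun s (lam_of r)" for r
  have "\<exists>r. 0 < r \<and> r < 1 \<and> B r = chain_ratio n r" for n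
    by (rule beta_lam_of_crossing[OF s, of "chain_ratio n"])
       (use chain_ratio_le_1[of "1/3" n] continuous_on_chain_ratio[of n] in
         \<open>auto simp: B_def chain_ratio_def[of n 1]\<close>)
  then obtain \<rho> where \<rho>: "\<And>n. 0 < \<rho> n" "\<And>n. \<rho> n < 1" "\<And>n. B (\<rho> n) = chain_ratio n (\<rho> n)"
    by metis
  have lam: "lambda_ds s (n + 2) = lam_of (\<rho> n)" for n
    using lambda_ds_eq_lam_of[of "\<rho> n" s n] \<rho>[of n] by (simp add: B_def)
  \<comment> \<open>Otherwise, passing from \<open>\<rho> (Suc n)\<close> at length index
    \<open>Suc n\<close> to \<open>\<rho> n\<close> at index \<open>n\<close> strictly raises the
    chain ratio, whereas \<open>B\<close> does not increase.\<close>
  have \<rho>_Suc: "\<rho> n < \<rho> (Suc n)" for n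
  proof (rule ccontr)
    assume "\<not> \<rho> n < \<rho> (Suc n)"
    hence le: "\<rho> (Suc n) \<le> \<rho> n" by simp
    have "chain_ratio (Suc n) (\<rho> (Suc n)) \<le> chain_ratio (Suc n) (\<rho> n)"
      by (rule chain_ratio_mono) (use \<rho>(1) le less_imp_le[OF \<rho>(2)] in auto)
    also have "\<dots> < chain_ratio n (\<rho> n)" by (rule chain_ratio_Suc_less) (use \<rho> in auto)
    also have "\<dots> \<le> B (\<rho> (Suc n))"
      unfolding \<rho>(3)[symmetric] B_def
      by (rule beta_lam_of_antimono) (use \<rho>(1) le less_imp_le[OF \<rho>(2)] in auto)
    finally show False by (simp add: \<rho>)
  qed
  show "\<forall>l\<ge>2. lambda_ds s (l + 1) < lambda_ds s l"
  proof (intro allI impI)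
    fix l :: nat assume "l \<ge> 2"
    then obtain n where l: "l = n + 2" by (metis le_add_diff_inverse2)
    show "lambda_ds s (l + 1) < lambda_ds s l"
      using lam[of n] lam[of "Suc n"] \<rho>_Suc[of n] \<rho>(1)[of n] less_imp_le[OF \<rho>(2)]
        lam_of_strict_antimono[of "\<rho> n" "\<rho> (Suc n)"] by (simp add: l)
  qed
  \<comment> \<open>The limit parameter: the chain ratio tends to the identity, so the limiting
    equation is the fixed point equation of the decreasing function \<open>B\<close>.\<close>
  obtain r where r: "0 < r" "r < 1" "B r = r"
    using beta_lam_of_crossing[OF s, of "\<lambda>r. r"] by (auto simp: B_def)
  have uniq: "r' = r" if "0 < r'" "r' < 1" "B r' = r'" for r'
    using beta_lam_of_strict_antimono[of r r' s] beta_lam_of_strict_antimono[of r' r s] r that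
    by (cases r r' rule: linorder_cases) (auto simp: B_def)
  \<comment> \<open>For \<open>\<rho> n\<close> beyond \<open>r\<close>, \<open>B (\<rho> n)\<close>
    would be at most \<open>r\<close>, yet it equals the chain ratio, which exceeds
    \<open>\<rho> n\<close>.\<close>
  have le: "\<rho> n \<le> r" for n
  proof (rule ccontr)
    assume "\<not> \<rho> n \<le> r"
    hence "B (\<rho> n) \<le> B r"
      unfolding B_def using r(1) less_imp_le[OF \<rho>(2)] by (intro beta_lam_of_antimono) auto
    thus False using chain_ratio_minus_id_bounds(1)[of "\<rho> n" n] \<rho>[of n] r \<open>\<not> \<rho> n \<le> r\<close> by simp
  qed
  \<comment> \<open>The excess of the chain ratio over \<open>\<rho> n\<close> is at most
    \<open>\<rho> n ^ n\<close>, and \<open>le\<close> replaces this by the null sequence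
    \<open>r ^ n\<close>.\<close>
  have ge: "r - r ^ n \<le> \<rho> n" for n
  proof -
    have "r \<le> B (\<rho> n)"
      using beta_lam_of_antimono[of "\<rho> n" r s] le[of n] \<rho>(1)[of n] r by (simp add: B_def)
    also have "\<dots> \<le> \<rho> n + \<rho> n ^ n"
      using chain_ratio_minus_id_bounds(2)[of "\<rho> n" n] \<rho>[of n] by simp
    also have "\<rho> n ^ n \<le> r ^ n" using le[of n] \<rho>(1)[of n] by (intro power_mono) auto
    finally show ?thesis by simp
  qed
  have "(\<lambda>n. r - r ^ n) \<longlonglongrightarrow> r - 0"
    using r by (intro tendsto_intros LIMSEQ_power_zero) auto
  hence "\<rho> \<longlonglongrightarrow> r"
    using le ge by (intro tendsto_sandwich[of "\<lambda>n. r - r ^ n" \<rho> sequentially "\<lambda>_. r"]) auto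
  hence "(\<lambda>n. lam_of (\<rho> n)) \<longlonglongrightarrow> lam_of r"
    unfolding lam_of_def using r by (intro tendsto_intros) auto
  hence "(\<lambda>n. lambda_ds s (n + 2)) \<longlonglongrightarrow> lam_of r" by (simp only: lam)
  hence lim: "(\<lambda>l. lambda_ds s l) \<longlonglongrightarrow> lam_of r" by (rule LIMSEQ_offset)
  have "q_fun x = beta_fun s x \<longleftrightarrow> x = lam_of r" if x: "x > 0" for x
  proof
    assume "q_fun x = beta_fun s x"
    hence "q_fun x = r" using lam_of_q_fun[OF x] by (intro uniq) (auto simp: B_def)
    thus "x = lam_of r" using lam_of_q_fun[OF x] by auto
  next
    assume "x = lam_of r"
    thus "q_fun x = beta_fun s x" using q_fun_lam_of[of r] r by (simp add: B_def)
  qed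
  moreover have "lam_of r > 0" using r by (simp add: lam_of_def)
  ultimately show "\<exists>lam_inf>0. (\<forall>x>0. q_fun x = beta_fun s x \<longleftrightarrow> x = lam_inf) \<and>
      (\<lambda>l. lambda_ds s l) \<longlonglongrightarrow> lam_inf"
    using lim by blast
qed

end
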